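(* If $G$ is a finitely generated group acting by isometries on an arbitrary quasitree $Q$, then the action is not parabolic. In particular, if every element of $G$ acts elliptically then $G$ acts on $Q$ with bounded orbits.
   Context: A quasitree is a geodesic metric space that is quasi-isometric to a simplicial tree; it is a (not necessarily proper) Gromov hyperbolic space. An isometric action of $G$ on a hyperbolic space $X$ is parabolic if the limit set $\partial_G X$ (the set of accumulation points of a $G$-orbit in the Gromov boundary $\partial X$) consists of exactly one point. An element $g$ acts elliptically if $\langle g\rangle$ has bounded orbits. *)

theory Defs
  imports
    "HOL-Analysis.Abstract_Metric_Spaces"
    "HOL-Algebra.Generated_Groups"
    "HOL-Algebra.Group_Action"
begin

section \<open>Simplicial trees\<close>

text \<open>A simplicial graph is given by a set \<open>V\<close> of vertices and a set \<open>E\<close> of two-element subsets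
  of \<open>V\<close>. No finiteness or local finiteness is assumed.\<close>

definition graph_walk :: "'v set \<Rightarrow> 'v set set \<Rightarrow> 'v list \<Rightarrow> bool" where
  "graph_walk V E p \<longleftrightarrow> p \<noteq> [] \<and> set p \<subseteq> V \<and> successively (\<lambda>u v. {u, v} \<in> E) p"

definition graph_cycle :: "'v set \<Rightarrow> 'v set set \<Rightarrow> 'v list \<Rightarrow> bool" where
  "graph_cycle V E p \<longleftrightarrow> graph_walk V E p \<and> distinct p \<and> 3 \<le> length p \<and> {last p, hd p} \<in> E"

definition simplicial_tree :: "'v set \<Rightarrow> 'v set set \<Rightarrow> bool" where
  "simplicial_tree V E \<longleftrightarrow>
     V \<noteq> {} \<and>
     E \<subseteq> {e. e \<subseteq> V \<and> card e = 2} \<and>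
     (\<forall>u\<in>V. \<forall>v\<in>V. \<exists>p. graph_walk V E p \<and> hd p = u \<and> last p = v) \<and>
     (\<nexists>p. graph_cycle V E p)"

definition simplices :: "'v set \<Rightarrow> 'v set set \<Rightarrow> 'v set set" where
  "simplices V E = (\<lambda>v. {v}) ` V \<union> E"

text \<open>Points of the geometric realization are given by their barycentric coordinates.\<close>

definition closed_cell :: "'v set \<Rightarrow> ('v \<Rightarrow> real) set" where
  "closed_cell s = {x. (\<forall>v. 0 \<le> x v) \<and> (\<forall>v. v \<notin> s \<longrightarrow> x v = 0) \<and> sum x s = 1}"

definition realization :: "'v set \<Rightarrow> 'v set set \<Rightarrow> ('v \<Rightarrow> real) set" where
  "realization V E = (\<Union>s\<in>simplices V E. closed_cell s)"

text \<open>The metric is the path metric for which every edge has length one: the infimum of the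
  lengths of finite strings of points in which consecutive points lie in a common closed cell.
  Inside the cell of an edge \<open>{a, b}\<close> one has \<open>cell_dist x y = \<bar>x a - y a\<bar>\<close>.\<close>

definition cell_dist :: "('v \<Rightarrow> real) \<Rightarrow> ('v \<Rightarrow> real) \<Rightarrow> real" where
  "cell_dist x y = (\<Sum>v | x v \<noteq> 0 \<or> y v \<noteq> 0. \<bar>x v - y v\<bar>) / 2"

definition strings ::
    "'v set \<Rightarrow> 'v set set \<Rightarrow> ('v \<Rightarrow> real) \<Rightarrow> ('v \<Rightarrow> real) \<Rightarrow> ('v \<Rightarrow> real) list set" where
  "strings V E x y =
     {p. p \<noteq> [] \<and> hd p = x \<and> last p = y \<and>
         successively (\<lambda>a b. \<exists>s\<in>simplices V E. a \<in> closed_cell s \<and> b \<in> closed_cell s) p}"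

definition string_length :: "('v \<Rightarrow> real) list \<Rightarrow> real" where
  "string_length p = (\<Sum>i<length p - 1. cell_dist (p ! i) (p ! Suc i))"

definition realization_dist :: "'v set \<Rightarrow> 'v set set \<Rightarrow> ('v \<Rightarrow> real) \<Rightarrow> ('v \<Rightarrow> real) \<Rightarrow> real" where
  "realization_dist V E x y = (INF p\<in>strings V E x y. string_length p)"


section \<open>Quasitrees\<close>

definition quasi_isometric ::
    "'a set \<Rightarrow> ('a \<Rightarrow> 'a \<Rightarrow> real) \<Rightarrow> 'b set \<Rightarrow> ('b \<Rightarrow> 'b \<Rightarrow> real) \<Rightarrow> bool" where
  "quasi_isometric M d M' d' \<longleftrightarrow>
     (\<exists>f K C. f \<in> M \<rightarrow> M' \<and> 1 \<le> K \<and> 0 \<le> C \<and>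
        (\<forall>x\<in>M. \<forall>y\<in>M. d x y / K - C \<le> d' (f x) (f y) \<and> d' (f x) (f y) \<le> K * d x y + C) \<and>
        (\<forall>z\<in>M'. \<exists>x\<in>M. d' (f x) z \<le> C))"

definition geodesic_space :: "'a set \<Rightarrow> ('a \<Rightarrow> 'a \<Rightarrow> real) \<Rightarrow> bool" where
  "geodesic_space M d \<longleftrightarrow>
     Metric_space M d \<and>
     (\<forall>x\<in>M. \<forall>y\<in>M. \<exists>\<gamma> :: real \<Rightarrow> 'a.
        \<gamma> \<in> {0..d x y} \<rightarrow> M \<and> \<gamma> 0 = x \<and> \<gamma> (d x y) = y \<and>
        (\<forall>s\<in>{0..d x y}. \<forall>t\<in>{0..d x y}. d (\<gamma> s) (\<gamma> t) = \<bar>s - t\<bar>))"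

text \<open>A definition cannot quantify over the type of vertices of the tree, so that type is passed
  as an argument. A theorem assuming \<open>quasitree TYPE('v) M d\<close> with a type variable \<open>'v\<close> covers trees
  of every cardinality.\<close>

definition quasitree :: "'v itself \<Rightarrow> 'a set \<Rightarrow> ('a \<Rightarrow> 'a \<Rightarrow> real) \<Rightarrow> bool" where
  "quasitree _ M d \<longleftrightarrow>
     geodesic_space M d \<and>
     (\<exists>(V :: 'v set) E. simplicial_tree V E \<and>
        quasi_isometric M d (realization V E) (realization_dist V E))"


section \<open>The Gromov boundary\<close>

text \<open>The sequential boundary, which is the usual one for hyperbolic spaces that need not be
  proper. On a hyperbolic space \<open>gromov_rel\<close> is an equivalence relation, and the conditions
  below do not depend on the base point \<open>a\<close>.\<close>

context Metric_space
begin

definition gromov_product :: "'a \<Rightarrow> 'a \<Rightarrow> 'a \<Rightarrow> real" where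
  "gromov_product a x y = (d x a + d y a - d x y) / 2"

definition gromov_sequence :: "(nat \<Rightarrow> 'a) \<Rightarrow> bool" where
  "gromov_sequence u \<longleftrightarrow>
     range u \<subseteq> M \<and>
     (\<forall>a\<in>M. filterlim (\<lambda>(m, n). gromov_product a (u m) (u n)) at_top
               (sequentially \<times>\<^sub>F sequentially))"

definition gromov_rel :: "((nat \<Rightarrow> 'a) \<times> (nat \<Rightarrow> 'a)) set" where
  "gromov_rel = {(u, v). gromov_sequence u \<and> gromov_sequence v \<and>
     (\<forall>a\<in>M. filterlim (\<lambda>n. gromov_product a (u n) (v n)) at_top sequentially)}"

definition gromov_boundary :: "(nat \<Rightarrow> 'a) set set" where
  "gromov_boundary = Collect gromov_sequence // gromov_rel"

text \<open>A sequence of points of \<open>M\<close> converges to \<open>\<xi>\<close> in \<open>gromov_boundary\<close> iff it is one of the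
  Gromov sequences in the class \<open>\<xi>\<close>; such a sequence is unbounded.\<close>

definition boundary_accumulation_points :: "'a set \<Rightarrow> (nat \<Rightarrow> 'a) set set" where
  "boundary_accumulation_points S = {\<xi> \<in> gromov_boundary. \<exists>u\<in>\<xi>. range u \<subseteq> S}"

end


section \<open>Isometric actions\<close>

locale isometric_action = group_action G M \<phi> + Metric_space M d
  for G (structure) and M and d and \<phi> +
  assumes isometry: "\<lbrakk>g \<in> carrier G; x \<in> M; y \<in> M\<rbrakk> \<Longrightarrow> d (\<phi> g x) (\<phi> g y) = d x y"

definition finitely_generated :: "('g, 'm) monoid_scheme \<Rightarrow> bool" where
  "finitely_generated G \<longleftrightarrow> (\<exists>S. finite S \<and> S \<subseteq> carrier G \<and> generate G S = carrier G)"

definition limit_set ::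
    "('g, 'm) monoid_scheme \<Rightarrow> 'a set \<Rightarrow> ('a \<Rightarrow> 'a \<Rightarrow> real) \<Rightarrow> ('g \<Rightarrow> 'a \<Rightarrow> 'a) \<Rightarrow> 'a
      \<Rightarrow> (nat \<Rightarrow> 'a) set set" where
  "limit_set G M d \<phi> x = Metric_space.boundary_accumulation_points M d (orbit G \<phi> x)"

text \<open>For an isometric action on a hyperbolic space the limit set does not depend on the orbit.\<close>

definition parabolic_action ::
    "('g, 'm) monoid_scheme \<Rightarrow> 'a set \<Rightarrow> ('a \<Rightarrow> 'a \<Rightarrow> real) \<Rightarrow> ('g \<Rightarrow> 'a \<Rightarrow> 'a) \<Rightarrow> bool" where
  "parabolic_action G M d \<phi> \<longleftrightarrow> (\<exists>x\<in>M. \<exists>\<xi>. limit_set G M d \<phi> x = {\<xi>})"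

definition bounded_orbits ::
    "('g, 'm) monoid_scheme \<Rightarrow> 'a set \<Rightarrow> ('a \<Rightarrow> 'a \<Rightarrow> real) \<Rightarrow> ('g \<Rightarrow> 'a \<Rightarrow> 'a) \<Rightarrow> bool" where
  "bounded_orbits G M d \<phi> \<longleftrightarrow> (\<forall>x\<in>M. Metric_space.mbounded M d (orbit G \<phi> x))"

definition acts_elliptically ::
    "('g, 'm) monoid_scheme \<Rightarrow> 'a set \<Rightarrow> ('a \<Rightarrow> 'a \<Rightarrow> real) \<Rightarrow> ('g \<Rightarrow> 'a \<Rightarrow> 'a) \<Rightarrow> 'g \<Rightarrow> bool" where
  "acts_elliptically G M d \<phi> g \<longleftrightarrow> bounded_orbits (subgroup_generated G {g}) M d \<phi>"

end

theory Submission
  imports Defs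
begin

text \<open>In a tree, every string between two of three given points passes the median of the three.
  Through the quasi-isometry this gives a bottleneck property in a quasitree: every coarse path
  between the ends of a geodesic passes near each of its points. In particular the space is
  hyperbolic. If \<open>G\<close> is finitely generated, its orbits are coarse paths, so an orbit passes near
  the midpoint of any two of its points; if it is unbounded, then a ping-pong argument at such an
  orbit point produces a loxodromic element. A loxodromic element has two limit points and is not
  elliptic, whereas a bounded orbit has no limit points at all.\<close>

section \<open>Medians in simplicial trees\<close>

text \<open>Hyperbolicity alone does not suffice: the orbit of a horocyclic translation of the
  hyperbolic plane is a coarse path that stays far from the geodesics between its points. A coarse
  path in a tree cannot bypass a point in this way, and that feature survives although
  \<open>G\<close> acts on \<open>Q\<close> only and the quasi-isometry is neither equivariant nor
  continuous. Finite generation bounds the steps of an orbit. Without it the claim fails: the union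
  of a strictly increasing sequence of finite groups acts parabolically on its tree of cosets, and
  every element is elliptic.\<close>

definition connected_within :: "'v set set \<Rightarrow> 'v set \<Rightarrow> 'v \<Rightarrow> 'v \<Rightarrow> bool" where
  "connected_within E A u v \<longleftrightarrow> (\<exists>p. graph_walk A E p \<and> hd p = u \<and> last p = v)"

lemma graph_walk_rev: "graph_walk V E p \<Longrightarrow> graph_walk V E (rev p)"
  unfolding graph_walk_def by (simp add: insert_commute)

lemma graph_walk_append_tl:
  assumes "graph_walk V E p" "graph_walk V E q" "last p = hd q"
  shows "graph_walk V E (p @ tl q)" "hd (p @ tl q) = hd p" "last (p @ tl q) = last q"
  using assms
  by (cases q, simp add: graph_walk_def,
      auto simp: graph_walk_def successively_append_iff successively_Cons)+

lemma connected_within_sym: "connected_within E A u v \<Longrightarrow> connected_within E A v u"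
  unfolding connected_within_def
proof (elim exE conjE)
  fix p assume "graph_walk A E p" "hd p = u" "last p = v"
  then show "\<exists>q. graph_walk A E q \<and> hd q = v \<and> last q = u"
    by (intro exI[of _ "rev p"]) (simp add: graph_walk_rev hd_rev last_rev)
qed

lemma connected_within_trans:
  "connected_within E A u v \<Longrightarrow> connected_within E A v w \<Longrightarrow> connected_within E A u w"
  unfolding connected_within_def
proof (elim exE conjE)
  fix p q
  assume "graph_walk A E p" "hd p = u" "last p = v" "graph_walk A E q" "hd q = v" "last q = w"
  then show "\<exists>r. graph_walk A E r \<and> hd r = u \<and> last r = w"
    using graph_walk_append_tl[of A E p q] by auto
qed

lemma connected_withinI:
  "graph_walk V E p \<Longrightarrow> set p \<subseteq> A \<Longrightarrow> connected_within E A (hd p) (last p)"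
  unfolding connected_within_def graph_walk_def by blast

lemma connected_within_path:
  assumes "connected_within E A u v"
  obtains p where "graph_walk A E p" "hd p = u" "last p = v" "distinct p"
proof -
  let ?P = "\<lambda>p. graph_walk A E p \<and> hd p = u \<and> last p = v"
  have "\<exists>p. ?P p" using assms unfolding connected_within_def .
  then obtain p where p: "?P p" and min: "\<And>q. ?P q \<Longrightarrow> length p \<le> length q"
    using ex_has_least_nat[of ?P _ length] by blast
  have "distinct p"
  proof (rule ccontr)
    assume "\<not> distinct p"
    then obtain xs y ys zs where eq: "p = xs @ [y] @ ys @ [y] @ zs"
      using not_distinct_decomp by blast
    have "?P (xs @ [y] @ zs)"
      using p unfolding eq graph_walk_def
      by (cases xs) (auto simp: successively_append_iff successively_Cons hd_append split: if_splits)
    from min[OF this] show False by (simp add: eq)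
  qed
  with p that show thesis by blast
qed

text \<open>Otherwise the neighbours of the missed vertex on the path would be joined by a path avoiding
  it, which closes up to a cycle.\<close>

lemma path_subset_walk:
  assumes acyc: "\<nexists>p. graph_cycle V E p"
    and P: "graph_walk V E P" "distinct P" and W: "graph_walk V E W"
    and ends: "hd W = hd P" "last W = last P"
  shows "set P \<subseteq> set W"
proof
  fix p assume "p \<in> set P"
  then obtain p1 p2 where eq: "P = p1 @ p # p2" by (meson split_list)
  show "p \<in> set W"
  proof (rule ccontr)
    assume nW: "p \<notin> set W"
    have "W \<noteq> []" using W by (simp add: graph_walk_def)
    then have "hd W \<in> set W" "last W \<in> set W" by simp_all
    with nW have "p1 \<noteq> []" "p2 \<noteq> []" using ends eq by auto
    let ?u = "last p1" and ?w = "hd p2" and ?A = "V - {p}"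
    have w1: "graph_walk V E p1" "graph_walk V E p2"
      and e: "{?u, p} \<in> E" "{p, ?w} \<in> E"
      using P(1) \<open>p1 \<noteq> []\<close> \<open>p2 \<noteq> []\<close> unfolding eq graph_walk_def
      by (auto simp: successively_append_iff successively_Cons)
    have sub: "set p1 \<subseteq> ?A" "set p2 \<subseteq> ?A" "set W \<subseteq> ?A"
      using P nW W unfolding eq graph_walk_def by auto
    have "connected_within E ?A ?u (hd p1)"
      using connected_withinI[OF w1(1) sub(1)] by (rule connected_within_sym)
    moreover have "connected_within E ?A (hd p1) (last p2)"
      using connected_withinI[OF W sub(3)] ends eq \<open>p1 \<noteq> []\<close> \<open>p2 \<noteq> []\<close> by simp
    moreover have "connected_within E ?A (last p2) ?w"
      using connected_withinI[OF w1(2) sub(2)] by (rule connected_within_sym)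
    ultimately have "connected_within E ?A ?u ?w"
      by (blast intro: connected_within_trans)
    then obtain q where q: "graph_walk ?A E q" "hd q = ?u" "last q = ?w" "distinct q"
      by (rule connected_within_path)
    have "?u \<noteq> ?w" using P(2) \<open>p1 \<noteq> []\<close> \<open>p2 \<noteq> []\<close> unfolding eq
      by (metis Un_iff disjoint_iff distinct_append hd_in_set last_in_set list.set_intros(2))
    \<comment> \<open>With \<open>p\<close> in front, this reaches the length 3 that
      \<open>graph_cycle\<close> demands.\<close>
    then have "length q \<ge> 2" using q
      by (cases q; cases "tl q") (auto simp: graph_walk_def)
    moreover have "p \<in> V" using P(1) eq by (simp add: graph_walk_def)
    ultimately have "graph_cycle V E (p # q)"
      using q e unfolding graph_cycle_def graph_walk_def
      by (auto simp: successively_Cons insert_commute)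
    with acyc show False by blast
  qed
qed

text \<open>The median is where a path from \<open>c\<close> to \<open>a\<close> first hits a path
  from \<open>a\<close> to \<open>b\<close>. Being the first hit, it separates three legs that meet
  nowhere else, so the paths composed of two legs have distinct vertices and every walk with the
  same ends covers them.\<close>

lemma tree_median:
  assumes tree: "simplicial_tree V E" and abc: "a \<in> V" "b \<in> V" "c \<in> V"
  obtains p where
    "\<And>W x y. \<lbrakk>graph_walk V E W; hd W = x; last W = y;
       (x, y) \<in> {(a, b), (a, c), (b, c)}\<rbrakk> \<Longrightarrow> p \<in> set W"
proof -
  have acyc: "\<nexists>p. graph_cycle V E p"
    using tree unfolding simplicial_tree_def by simp
  have conn: "connected_within E V u v" if "u \<in> V" "v \<in> V" for u v
    using tree that unfolding simplicial_tree_def connected_within_def by simp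
  obtain P where P: "graph_walk V E P" "hd P = a" "last P = b" "distinct P"
    using connected_within_path[OF conn[OF abc(1,2)]] .
  obtain R where R: "graph_walk V E R" "hd R = c" "last R = a" "distinct R"
    using connected_within_path[OF conn[OF abc(3,1)]] .
  have "\<exists>p\<in>set R. p \<in> set P"
    using P R by (metis graph_walk_def hd_in_set last_in_set)
  then obtain r1 p r2 where r: "R = r1 @ p # r2" "p \<in> set P" "\<forall>y\<in>set r1. y \<notin> set P"
    using split_list_first_prop[of R "\<lambda>p. p \<in> set P"] by blast
  obtain p1 p2 where p: "P = p1 @ p # p2" using r(2) by (meson split_list)
  let ?P1 = "p1 @ p # rev r1" and ?P2 = "rev p2 @ p # rev r1"
  have w: "graph_walk V E ?P1" "graph_walk V E ?P2"
    using P(1) R(1) unfolding p r(1) graph_walk_def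
    by (auto simp: successively_append_iff successively_Cons insert_commute hd_rev last_rev)
  have dist: "distinct ?P1" "distinct ?P2"
    using P(4) R(4) r(3) unfolding p r(1) by auto
  have ends: "hd ?P1 = a" "last ?P1 = c" "hd ?P2 = b" "last ?P2 = c"
    using P(2,3) R(2) unfolding p r(1)
    by (auto simp: hd_append last_rev hd_rev split: if_splits)
  show thesis
  proof
    fix W x y
    assume W: "graph_walk V E W" "hd W = x" "last W = y" "(x, y) \<in> {(a, b), (a, c), (b, c)}"
    then consider "hd W = a" "last W = b" | "hd W = a" "last W = c" | "hd W = b" "last W = c"
      by auto
    then show "p \<in> set W"
    proof cases
      case 1
      then show ?thesis using path_subset_walk[OF acyc P(1,4) W(1)] P r(2) by auto
    next
      case 2
      then show ?thesis using path_subset_walk[OF acyc w(1) dist(1) W(1)] ends by auto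
    next
      case 3
      then show ?thesis using path_subset_walk[OF acyc w(2) dist(2) W(1)] ends by auto
    qed
  qed
qed

section \<open>The geometric realization of a tree\<close>

definition vertex :: "'v \<Rightarrow> 'v \<Rightarrow> real" where
  "vertex v = (\<lambda>w. if w = v then 1 else 0)"

lemma vertex_inject [simp]: "vertex v = vertex w \<longleftrightarrow> v = w"
  by (auto simp: vertex_def fun_eq_iff split: if_splits)

definition share_cell :: "'v set \<Rightarrow> 'v set set \<Rightarrow> ('v \<Rightarrow> real) \<Rightarrow> ('v \<Rightarrow> real) \<Rightarrow> bool" where
  "share_cell V E a b \<longleftrightarrow> (\<exists>s\<in>simplices V E. a \<in> closed_cell s \<and> b \<in> closed_cell s)"

lemma share_cell_sym: "share_cell V E a b \<Longrightarrow> share_cell V E b a"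
  by (auto simp: share_cell_def)

lemma strings_iff:
  "p \<in> strings V E x y \<longleftrightarrow> p \<noteq> [] \<and> hd p = x \<and> last p = y \<and> successively (share_cell V E) p"
  by (simp add: strings_def share_cell_def[abs_def])

lemma vertex_in_closed_cell: "finite s \<Longrightarrow> vertex v \<in> closed_cell s \<longleftrightarrow> v \<in> s"
  by (auto simp: closed_cell_def vertex_def)

lemma in_closed_cell_singleton: "x \<in> closed_cell {v} \<longleftrightarrow> x = vertex v"
proof
  assume "x \<in> closed_cell {v}"
  then show "x = vertex v" by (auto simp: closed_cell_def vertex_def fun_eq_iff)
qed (auto simp: closed_cell_def vertex_def)

lemma closed_cell_Int:
  assumes "finite s" "finite t" "x \<in> closed_cell s" "x \<in> closed_cell t"
  shows "x \<in> closed_cell (s \<inter> t)"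
proof -
  have "sum x (s \<inter> t) = sum x s"
    using assms by (intro sum.mono_neutral_left) (auto simp: closed_cell_def)
  then show ?thesis using assms by (auto simp: closed_cell_def)
qed

lemma string_length_single [simp]: "string_length [x] = 0"
  by (simp add: string_length_def)

lemma string_length_Cons_Cons [simp]:
  "string_length (x # y # p) = cell_dist x y + string_length (y # p)"
  by (simp add: string_length_def sum.lessThan_Suc_shift del: sum.lessThan_Suc)

lemma string_length_append:
  "p \<noteq> [] \<Longrightarrow> string_length (p @ q) = string_length p + string_length (last p # q)"
proof (induction p rule: list_nonempty_induct)
  case (cons x xs)
  then show ?case by (cases xs) auto
qed simp

lemma cell_dist_nonneg: "0 \<le> cell_dist x y"
  by (simp add: cell_dist_def sum_nonneg)

lemma cell_dist_commute: "cell_dist x y = cell_dist y x"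
  by (simp add: cell_dist_def disj_commute abs_minus_commute)

lemma string_length_nonneg: "0 \<le> string_length p"
  by (simp add: string_length_def sum_nonneg cell_dist_nonneg)

lemma string_length_rev: "string_length (rev p) = string_length p"
proof (induction p rule: induct_list012)
  case (3 x y zs)
  have "string_length (rev (x # y # zs)) = string_length (rev (y # zs)) + cell_dist y x"
    using string_length_append[of "rev (y # zs)" "[x]"] by simp
  then show ?case using 3 by (simp add: cell_dist_commute)
qed (simp_all add: string_length_def)

locale tree_realization =
  fixes V :: "'v set" and E :: "'v set set"
  assumes tree: "simplicial_tree V E"
begin

lemma simplexE:
  assumes "s \<in> simplices V E"
  obtains v where "v \<in> V" "s = {v}" | u v where "u \<in> V" "v \<in> V" "u \<noteq> v" "s = {u, v}" "s \<in> E"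
proof -
  have E: "e \<subseteq> V \<and> card e = 2" if "e \<in> E" for e
    using tree that unfolding simplicial_tree_def by blast
  from assms consider v where "v \<in> V" "s = {v}" | "s \<in> E" unfolding simplices_def by blast
  then show thesis
  proof cases
    case 2
    then obtain x y where "s = {x, y}" "x \<noteq> y" using E by (meson card_2_iff)
    with 2 E that(2) show thesis by blast
  qed (use that(1) in blast)
qed

lemma finite_simplex: "s \<in> simplices V E \<Longrightarrow> finite s"
  by (erule simplexE) auto

text \<open>Edges have two vertices, so distinct cells overlap in at most one vertex: a string can
  change cells only at a vertex.\<close>

lemma simplex_Int:
  assumes "s \<in> simplices V E" "t \<in> simplices V E" "s \<noteq> t" "x \<in> closed_cell s" "x \<in> closed_cell t"
  obtains v where "x = vertex v"
proof -
  have x: "x \<in> closed_cell (s \<inter> t)"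
    using closed_cell_Int finite_simplex assms by blast
  then have "s \<inter> t \<noteq> {}" by (auto simp: closed_cell_def)
  then obtain v where "s \<inter> t = {v}"
    using assms(1-3) by (elim simplexE) auto
  with x that show thesis by (auto simp: in_closed_cell_singleton)
qed

text \<open>Sharing a cell is not transitive, since a string may turn into another edge at a vertex.
  The last premise leaves \<open>vertex v\<close> as the only vertex that \<open>x\<close> may be;
  any other \<open>x\<close> lies in a single cell.\<close>

lemma share_cell_trans:
  assumes "share_cell V E (vertex v) x" "share_cell V E x y" "\<And>w. x = vertex w \<Longrightarrow> w = v"
  shows "share_cell V E (vertex v) y"
proof (cases "x = vertex v")
  case False
  obtain s t where st: "s \<in> simplices V E" "vertex v \<in> closed_cell s" "x \<in> closed_cell s"
    "t \<in> simplices V E" "x \<in> closed_cell t" "y \<in> closed_cell t"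
    using assms(1,2) unfolding share_cell_def by blast
  have "s = t"
  proof (rule ccontr)
    assume "s \<noteq> t"
    then obtain w where "x = vertex w" using simplex_Int[OF st(1,4) _ st(3,5)] by auto
    with assms(3)[of w] False show False by simp
  qed
  with st show ?thesis unfolding share_cell_def by blast
qed (use assms(2) in simp)

lemma share_cell_vertices:
  assumes "share_cell V E (vertex v) (vertex w)"
  shows "v \<in> V" "v = w \<or> {v, w} \<in> E"
proof -
  obtain s where s: "s \<in> simplices V E" "vertex v \<in> closed_cell s" "vertex w \<in> closed_cell s"
    using assms unfolding share_cell_def by blast
  then have vw: "v \<in> s" "w \<in> s" using vertex_in_closed_cell[OF finite_simplex[OF s(1)]] by simp_all
  show "v \<in> V" using s(1) vw(1) by (cases rule: simplexE) auto
  show "v = w \<or> {v, w} \<in> E"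
    using s(1)
  proof (cases rule: simplexE)
    case (2 x y)
    then have "v = w \<or> s = {v, w}" using vw by auto
    with 2 show ?thesis by auto
  qed (use vw in auto)
qed

text \<open>The walk records the vertices that the string meets; until it meets a new one, the
  string stays in cells around the last one. The final conjunct makes the walk end where the string
  ends if that is a vertex.\<close>

lemma string_walk:
  assumes "\<sigma> \<noteq> []" "hd \<sigma> = vertex a" "a \<in> V" "successively (share_cell V E) \<sigma>"
  shows "\<exists>W. graph_walk V E W \<and> hd W = a \<and> vertex ` set W \<subseteq> set \<sigma> \<and>
    share_cell V E (vertex (last W)) (last \<sigma>) \<and> (\<forall>w. last \<sigma> = vertex w \<longrightarrow> w = last W)"
  using assms
proof (induction \<sigma> rule: rev_nonempty_induct)
  case (single x)
  have "share_cell V E (vertex a) (vertex a)"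
    using \<open>a \<in> V\<close> unfolding share_cell_def simplices_def
    by (intro bexI[of _ "{a}"]) (auto simp: in_closed_cell_singleton)
  with single show ?case by (intro exI[of _ "[a]"]) (auto simp: graph_walk_def)
next
  case (snoc x xs)
  then obtain W where W: "graph_walk V E W" "hd W = a" "vertex ` set W \<subseteq> set xs"
    "share_cell V E (vertex (last W)) (last xs)" "\<forall>w. last xs = vertex w \<longrightarrow> w = last W"
    by (auto simp: successively_append_iff)
  let ?v = "last W"
  have sh: "share_cell V E (vertex ?v) x"
    using share_cell_trans[OF W(4), of x] W(5) snoc.hyps snoc.prems
    by (simp add: successively_append_iff)
  show ?case
  proof (cases "\<exists>w. x = vertex w \<and> w \<noteq> ?v")
    case True
    then obtain w where w: "x = vertex w" "w \<noteq> ?v" by blast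
    have e: "{?v, w} \<in> E" "w \<in> V"
      using share_cell_vertices(2)[of ?v w] share_cell_vertices(1)[of w ?v] sh share_cell_sym[OF sh] w
      by auto
    have "share_cell V E (vertex w) (vertex w)"
      using \<open>w \<in> V\<close> unfolding share_cell_def simplices_def
      by (intro bexI[of _ "{w}"]) (auto simp: in_closed_cell_singleton)
    then show ?thesis using W(1-3) e w
      by (intro exI[of _ "W @ [w]"]) (auto simp: graph_walk_def successively_append_iff)
  next
    case False
    then show ?thesis using W(1-3) sh by (intro exI[of _ W]) auto
  qed
qed

lemma string_between_vertices:
  assumes "\<sigma> \<in> strings V E (vertex a) (vertex b)" "a \<in> V"
  obtains W where "graph_walk V E W" "hd W = a" "last W = b" "vertex ` set W \<subseteq> set \<sigma>"
proof -
  obtain W where "graph_walk V E W" "hd W = a" "vertex ` set W \<subseteq> set \<sigma>"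
    "\<forall>w. last \<sigma> = vertex w \<longrightarrow> w = last W"
    using string_walk[of \<sigma> a] assms unfolding strings_iff by blast
  with assms(1) that show thesis unfolding strings_iff by blast
qed

lemma realization_vertex:
  assumes "x \<in> realization V E"
  obtains v where "v \<in> V" "share_cell V E x (vertex v)"
proof -
  obtain s where s: "s \<in> simplices V E" "x \<in> closed_cell s"
    using assms unfolding realization_def by blast
  obtain v where v: "v \<in> s" "v \<in> V" using s(1) by (rule simplexE) auto
  then have "share_cell V E x (vertex v)"
    unfolding share_cell_def
    using s vertex_in_closed_cell[OF finite_simplex[OF s(1)], of v] by blast
  with v that show thesis by blast
qed

text \<open>Each point is moved to a vertex of its cell, and a string is extended by these vertices
  at both ends. The median may be one of the added vertices; then an end of the string shares a cell
  with it, hence the disjunction.\<close>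

lemma realization_median:
  assumes "a \<in> realization V E" "b \<in> realization V E" "c \<in> realization V E"
  obtains p where
    "\<forall>(x, y)\<in>{(a, b), (a, c), (b, c)}. \<forall>\<sigma>\<in>strings V E x y.
       \<exists>w\<in>set \<sigma>. w = p \<or> share_cell V E w p"
proof -
  obtain a' where a: "a' \<in> V" "share_cell V E a (vertex a')" using realization_vertex assms(1) .
  obtain b' where b: "b' \<in> V" "share_cell V E b (vertex b')" using realization_vertex assms(2) .
  obtain c' where c: "c' \<in> V" "share_cell V E c (vertex c')" using realization_vertex assms(3) .
  obtain p where p: "\<And>W x y. \<lbrakk>graph_walk V E W; hd W = x; last W = y;
       (x, y) \<in> {(a', b'), (a', c'), (b', c')}\<rbrakk> \<Longrightarrow> p \<in> set W"
    using tree_median[OF tree a(1) b(1) c(1)] by blast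
  have main: "\<exists>w\<in>set \<sigma>. w = vertex p \<or> share_cell V E w (vertex p)"
    if \<sigma>: "\<sigma> \<in> strings V E x y" and x: "share_cell V E x (vertex x')" "x' \<in> V"
      and y: "share_cell V E y (vertex y')" and xy: "(x', y') \<in> {(a', b'), (a', c'), (b', c')}"
    for \<sigma> x y x' y'
  proof -
    have "vertex x' # \<sigma> @ [vertex y'] \<in> strings V E (vertex x') (vertex y')"
      using \<sigma> x(1) y share_cell_sym unfolding strings_iff
      by (auto simp: successively_append_iff successively_Cons)
    then obtain W where W: "graph_walk V E W" "hd W = x'" "last W = y'"
      "vertex ` set W \<subseteq> set (vertex x' # \<sigma> @ [vertex y'])"
      using string_between_vertices x(2) by blast
    then have "vertex p \<in> set (vertex x' # \<sigma> @ [vertex y'])" using p xy by blast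
    moreover have "x \<in> set \<sigma>" "y \<in> set \<sigma>" using \<sigma> unfolding strings_iff by auto
    ultimately show ?thesis using x(1) y by auto
  qed
  show thesis
  proof (rule that[of "vertex p"], clarify)
    fix x y \<sigma> assume *: "(x, y) \<in> {(a, b), (a, c), (b, c)}" "\<sigma> \<in> strings V E x y"
    then consider "x = a" "y = b" | "x = a" "y = c" | "x = b" "y = c" by auto
    then show "\<exists>w\<in>set \<sigma>. w = vertex p \<or> share_cell V E w (vertex p)"
    proof cases
      case 1
      then show ?thesis using main[of \<sigma> a b a' b'] *(2) a b by blast
    next
      case 2
      then show ?thesis using main[of \<sigma> a c a' c'] *(2) a c by blast
    next
      case 3
      then show ?thesis using main[of \<sigma> b c b' c'] *(2) b c by blast
    qed
  qed
qed

section \<open>Lengths of strings and the infimum metric\<close>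

lemma cell_dist_le_1:
  assumes "share_cell V E x y" shows "cell_dist x y \<le> 1"
proof -
  obtain s where s: "s \<in> simplices V E" "x \<in> closed_cell s" "y \<in> closed_cell s"
    using assms unfolding share_cell_def by blast
  have "(\<Sum>v | x v \<noteq> 0 \<or> y v \<noteq> 0. \<bar>x v - y v\<bar>) \<le> (\<Sum>v\<in>s. \<bar>x v - y v\<bar>)"
    using s finite_simplex by (intro sum_mono2) (auto simp: closed_cell_def)
  also have "\<dots> \<le> (\<Sum>v\<in>s. x v + y v)"
    using s by (intro sum_mono) (auto simp: closed_cell_def abs_le_iff)
  also have "\<dots> = 2" using s by (simp add: sum.distrib closed_cell_def)
  finally show ?thesis by (simp add: cell_dist_def)
qed

text \<open>An actual string in place of the infimum makes symmetry and concatenation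
  immediate.\<close>

definition joined :: "real \<Rightarrow> ('v \<Rightarrow> real) \<Rightarrow> ('v \<Rightarrow> real) \<Rightarrow> bool" where
  "joined r x y \<longleftrightarrow> (\<exists>p\<in>strings V E x y. string_length p \<le> r)"

lemma joined_refl: "0 \<le> r \<Longrightarrow> joined r x x"
  unfolding joined_def by (intro bexI[of _ "[x]"]) (auto simp: strings_iff)

lemma share_cell_joined: "share_cell V E x y \<Longrightarrow> joined 1 x y"
  unfolding joined_def
  by (intro bexI[of _ "[x, y]"]) (auto simp: strings_iff cell_dist_le_1)

lemma joined_sym: "joined r x y \<Longrightarrow> joined r y x"
  unfolding joined_def
proof (elim bexE)
  fix p assume "p \<in> strings V E x y" "string_length p \<le> r"
  then show "\<exists>p\<in>strings V E y x. string_length p \<le> r"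
    by (intro bexI[of _ "rev p"])
      (auto simp: strings_iff string_length_rev hd_rev last_rev
        elim: successively_mono intro: share_cell_sym)
qed

lemma strings_append_tl:
  assumes "p \<in> strings V E x y" "q \<in> strings V E y z"
  shows "p @ tl q \<in> strings V E x z" "string_length (p @ tl q) = string_length p + string_length q"
proof -
  obtain q' where q: "q = y # q'" using assms(2) by (cases q) (auto simp: strings_iff)
  show "p @ tl q \<in> strings V E x z"
    using assms unfolding q by (auto simp: strings_iff successively_append_iff successively_Cons)
  show "string_length (p @ tl q) = string_length p + string_length q"
    using assms unfolding q by (auto simp: strings_iff string_length_append)
qed

lemma joined_trans: "joined r x y \<Longrightarrow> joined t y z \<Longrightarrow> joined (r + t) x z"
  unfolding joined_def
proof (elim bexE)
  fix p q
  assume *: "p \<in> strings V E x y" "q \<in> strings V E y z" "string_length p \<le> r" "string_length q \<le> t"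
  then show "\<exists>p\<in>strings V E x z. string_length p \<le> r + t"
    using strings_append_tl[OF *(1,2)] by (intro bexI[of _ "p @ tl q"]) auto
qed

lemma joined_string:
  assumes "\<sigma> \<in> strings V E x y" "w \<in> set \<sigma>"
  shows "joined (string_length \<sigma>) x w"
proof -
  obtain s1 s2 where eq: "\<sigma> = s1 @ w # s2" using assms(2) by (meson split_list)
  have "s1 @ [w] \<in> strings V E x w"
    using assms(1) unfolding eq
    by (cases s1)
      (auto simp: strings_iff successively_append_iff successively_Cons hd_append split: if_splits)
  moreover have "string_length (s1 @ [w]) \<le> string_length \<sigma>"
    using string_length_append[of "s1 @ [w]" s2] string_length_nonneg unfolding eq by simp
  ultimately show ?thesis unfolding joined_def by blast
qed

lemma strings_nonempty:
  assumes "x \<in> realization V E" "y \<in> realization V E"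
  shows "strings V E x y \<noteq> {}"
proof -
  obtain v where v: "v \<in> V" "share_cell V E x (vertex v)" using realization_vertex assms(1) .
  obtain w where w: "w \<in> V" "share_cell V E y (vertex w)" using realization_vertex assms(2) .
  obtain W where W: "graph_walk V E W" "hd W = v" "last W = w"
    using tree v w unfolding simplicial_tree_def by blast
  have edge: "share_cell V E (vertex a) (vertex b)" if "{a, b} \<in> E" for a b
  proof -
    have "{a, b} \<in> simplices V E" using that by (simp add: simplices_def)
    then show ?thesis unfolding share_cell_def
      by (intro bexI[of _ "{a, b}"]) (auto simp: vertex_in_closed_cell)
  qed
  have "x # map vertex W @ [y] \<in> strings V E x y"
    using W v(2) share_cell_sym[OF w(2)] edge
    by (auto simp: strings_iff graph_walk_def successively_append_iff successively_Cons
      successively_map hd_map last_map elim: successively_mono)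
  then show ?thesis by blast
qed

lemma realization_dist_le: "joined r x y \<Longrightarrow> realization_dist V E x y \<le> r"
  unfolding joined_def realization_dist_def
proof (elim bexE)
  fix p assume "p \<in> strings V E x y" "string_length p \<le> r"
  moreover have "bdd_below (string_length ` strings V E x y)"
    by (rule bdd_belowI2[of _ 0]) (rule string_length_nonneg)
  ultimately show "(INF p\<in>strings V E x y. string_length p) \<le> r"
    by (meson cINF_lower2)
qed

lemma joinedI:
  assumes "x \<in> realization V E" "y \<in> realization V E" "realization_dist V E x y < r"
  shows "joined r x y"
proof -
  have "string_length ` strings V E x y \<noteq> {}" using strings_nonempty assms by blast
  from cInf_lessD[OF this] assms(3) show ?thesis
    unfolding realization_dist_def joined_def by force
qed

end

section \<open>Bottlenecks and hyperbolicity\<close>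

context Metric_space
begin

text \<open>The metric interval: in a geodesic space, the union of all geodesics from
  \<open>x\<close> to \<open>y\<close>, so that none has to be chosen.\<close>

definition segment :: "'a \<Rightarrow> 'a \<Rightarrow> 'a set" where
  "segment x y = {z \<in> M. d x z + d z y = d x y}"

definition chained :: "real \<Rightarrow> 'a set \<Rightarrow> 'a \<Rightarrow> 'a \<Rightarrow> bool" where
  "chained L A = (\<lambda>u v. u \<in> A \<and> v \<in> A \<and> d u v \<le> L)\<^sup>*\<^sup>*"

text \<open>Manning's bottleneck property, with chains for paths and all points of a geodesic for
  its midpoint. As \<open>chained\<close> is reflexive even outside \<open>A\<close>, the start must
  be required to lie in \<open>A\<close>.\<close>

definition bottleneck :: "real \<Rightarrow> real \<Rightarrow> bool" where
  "bottleneck L \<Delta> \<longleftrightarrow>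
     (\<forall>x\<in>M. \<forall>y\<in>M. \<forall>m\<in>segment x y. \<forall>A\<subseteq>M. x \<in> A \<longrightarrow> chained L A x y \<longrightarrow> (\<exists>a\<in>A. d a m \<le> \<Delta>))"

definition four_point :: "real \<Rightarrow> bool" where
  "four_point \<delta> \<longleftrightarrow> (\<forall>w\<in>M. \<forall>x\<in>M. \<forall>y\<in>M. \<forall>z\<in>M.
     min (gromov_product w x y) (gromov_product w y z) \<le> gromov_product w x z + \<delta>)"

lemma gromov_product_commute: "gromov_product a x y = gromov_product a y x"
  by (simp add: gromov_product_def commute)

lemma chained_mono: "chained L A x y \<Longrightarrow> L \<le> L' \<Longrightarrow> A \<subseteq> B \<Longrightarrow> chained L' B x y"
  unfolding chained_def by (erule rtranclp_mono[THEN predicate2D, rotated]) auto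

lemma chained_trans: "chained L A x y \<Longrightarrow> chained L A y z \<Longrightarrow> chained L A x z"
  unfolding chained_def by (rule rtranclp_trans)

lemma chained_refl: "chained L A x x"
  unfolding chained_def by simp

lemma chained_step: "x \<in> A \<Longrightarrow> y \<in> A \<Longrightarrow> d x y \<le> L \<Longrightarrow> chained L A x y"
  unfolding chained_def by (simp add: r_into_rtranclp)

lemma segment_ends: "x \<in> M \<Longrightarrow> y \<in> M \<Longrightarrow> x \<in> segment x y \<and> y \<in> segment x y"
  by (simp add: segment_def)

lemma geodesic_pointE:
  assumes "geodesic_space M d" "x \<in> M" "y \<in> M" "0 \<le> t" "t \<le> d x y"
  obtains m where "m \<in> segment x y" "d x m = t"
proof -
  obtain \<gamma> where \<gamma>: "\<gamma> \<in> {0..d x y} \<rightarrow> M" "\<gamma> 0 = x" "\<gamma> (d x y) = y"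
    "\<And>s t. s \<in> {0..d x y} \<Longrightarrow> t \<in> {0..d x y} \<Longrightarrow> d (\<gamma> s) (\<gamma> t) = \<bar>s - t\<bar>"
    using assms unfolding geodesic_space_def by blast
  show thesis
  proof (rule that[of "\<gamma> t"])
    show "\<gamma> t \<in> segment x y" "d x (\<gamma> t) = t"
      using \<gamma>(1) \<gamma>(2,3) \<gamma>(4)[of 0 t] \<gamma>(4)[of t "d x y"] assms(4,5)
      by (auto simp: segment_def)
  qed
qed

lemma chained_segment:
  assumes "geodesic_space M d" "x \<in> M" "y \<in> M"
  shows "chained 1 (segment x y) x y"
proof -
  obtain \<gamma> where \<gamma>: "\<gamma> \<in> {0..d x y} \<rightarrow> M" "\<gamma> 0 = x" "\<gamma> (d x y) = y"
    "\<And>s t. s \<in> {0..d x y} \<Longrightarrow> t \<in> {0..d x y} \<Longrightarrow> d (\<gamma> s) (\<gamma> t) = \<bar>s - t\<bar>"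
    using assms unfolding geodesic_space_def by blast
  let ?z = "\<lambda>n. \<gamma> (min (real n) (d x y))"
  have seg: "?z n \<in> segment x y" for n
    using \<gamma>(1) \<gamma>(2,3) \<gamma>(4)[of 0 "min (real n) (d x y)"] \<gamma>(4)[of "min (real n) (d x y)" "d x y"]
    by (auto simp: segment_def)
  have "chained 1 (segment x y) x (?z n)" for n
  proof (induction n)
    case (Suc n)
    have "d (?z n) (?z (Suc n)) = \<bar>min (real n) (d x y) - min (real (Suc n)) (d x y)\<bar>"
      by (rule \<gamma>(4)) auto
    then have "d (?z n) (?z (Suc n)) \<le> 1" by auto
    with Suc seg chained_step chained_trans show ?case by meson
  qed (simp add: \<gamma>(2) chained_refl)
  moreover obtain n :: nat where "d x y \<le> real n" using real_arch_simple by blast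
  then have "?z n = y" using \<gamma>(3) by simp
  ultimately show ?thesis by metis
qed

text \<open>A geodesic triangle is a chain, so the bottleneck property makes triangles thin. Applied to
  the point of \<open>segment w y\<close> at distance \<open>min (gromov_product w x y) (gromov_product w y z)\<close>
  from \<open>w\<close>, this shows that the point lies near both \<open>segment w x\<close> and \<open>segment w z\<close>.\<close>

lemma bottleneck_imp_four_point:
  assumes geo: "geodesic_space M d" and bn: "bottleneck 1 \<Delta>"
  shows "four_point (4 * \<Delta>)"
proof -
  have near: "d w q + d q x \<le> d w x + 4 * \<Delta>"
    if w: "w \<in> M" "x \<in> M" "y \<in> M" and q: "q \<in> segment w y" "d w q \<le> gromov_product w x y"
    for w x y q
  proof -
    let ?A = "segment w x \<union> segment x y"
    have "chained 1 ?A w x" "chained 1 ?A x y"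
      by (rule chained_mono[OF chained_segment[OF geo]]; use w in auto)+
    then have "chained 1 ?A w y" by (rule chained_trans)
    moreover have "?A \<subseteq> M" "w \<in> ?A" using w segment_ends by (auto simp: segment_def)
    ultimately obtain r where r: "r \<in> ?A" "d r q \<le> \<Delta>"
      using bn w q(1) unfolding bottleneck_def by blast
    have M: "r \<in> M" "q \<in> M" using r(1) q(1) by (auto simp: segment_def)
    have "d w q \<le> d w r + d r q" "d q x \<le> d q r + d r x" "d w r \<le> d w q + d q r"
      "d w y \<le> d w r + d r y"
      using triangle w M by blast+
    moreover have "d q r = d r q" "d x r = d r x" "d x w = d w x" "d y w = d w y"
      by (rule commute)+
    \<comment> \<open>If \<open>r\<close> is on the side opposite to \<open>w\<close>, the bound on
      \<open>d w q\<close> gives the estimate: \<open>q\<close> has then not passed the point where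
      the geodesics from \<open>w\<close> to \<open>x\<close> and to \<open>y\<close>
      diverge.\<close>
    moreover have "d w r + d r x = d w x \<or> d x r + d r y = d x y"
      using r(1) by (auto simp: segment_def)
    ultimately show ?thesis using r(2) q(2) unfolding gromov_product_def by argo
  qed
  show ?thesis
    unfolding four_point_def
  proof (intro ballI)
    fix w x y z assume M: "w \<in> M" "x \<in> M" "y \<in> M" "z \<in> M"
    let ?t = "min (gromov_product w x y) (gromov_product w y z)"
    have "d x y \<le> d x w + d w y" "d y z \<le> d y w + d w z" "d w x \<le> d w y + d y x"
      "d w y \<le> d w x + d x y" "d w z \<le> d w y + d y z"
      using triangle M by blast+
    moreover have "d x w = d w x" "d y w = d w y" "d z w = d w z" "d y x = d x y"
      by (rule commute)+
    ultimately have "0 \<le> ?t" "?t \<le> d w y"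
      unfolding gromov_product_def min_def by (simp_all add: field_simps)
    then obtain q where q: "q \<in> segment w y" "d w q = ?t"
      using geodesic_pointE[OF geo] M by metis
    have "d w q + d q x \<le> d w x + 4 * \<Delta>"
      by (rule near[OF M(1-3) q(1)]) (simp add: q(2))
    moreover have "d w q + d q z \<le> d w z + 4 * \<Delta>"
      by (rule near[OF M(1,4,3) q(1)]) (simp add: q(2) gromov_product_commute[of w z y])
    moreover have "d x z \<le> d q x + d q z"
      using triangle[of x q z] M q(1) commute[of x q] by (auto simp: segment_def)
    \<comment> \<open>Two errors of \<open>4 * \<Delta>\<close> add up and are halved by the Gromov
      product.\<close>
    ultimately have "d w q \<le> gromov_product w x z + 4 * \<Delta>"
      using \<open>d x w = d w x\<close> \<open>d z w = d w z\<close> unfolding gromov_product_def by argo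
    with q(2) show "?t \<le> gromov_product w x z + 4 * \<Delta>" by simp
  qed
qed

text \<open>The image of a chain is a discrete sequence with gaps. Short strings fill them, and each
  point of a filling is close to the image of the chain point where its gap begins.\<close>

lemma chained_string:
  assumes tr: "tree_realization V E"
    and f: "f \<in> A \<rightarrow> realization V E"
    and step: "\<And>u v. u \<in> A \<Longrightarrow> v \<in> A \<Longrightarrow> d u v \<le> L \<Longrightarrow> realization_dist V E (f u) (f v) < c"
    and ch: "chained L A x y" and x: "x \<in> A" and c: "0 \<le> c"
  shows "y \<in> A \<and> (\<exists>\<sigma>\<in>strings V E (f x) (f y).
    \<forall>w\<in>set \<sigma>. \<exists>a\<in>A. tree_realization.joined V E c (f a) w)"
  using ch unfolding chained_def
proof (induction rule: rtranclp_induct)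
  interpret tree_realization V E by (rule tr)
  case base
  show ?case using x joined_refl[OF c]
    by (intro conjI bexI[of _ "[f x]"]) (auto simp: strings_iff)
next
  interpret tree_realization V E by (rule tr)
  case (step y z)
  then obtain \<sigma> where \<sigma>: "\<sigma> \<in> strings V E (f x) (f y)" "\<forall>w\<in>set \<sigma>. \<exists>a\<in>A. joined c (f a) w"
    by blast
  have "joined c (f y) (f z)" using step f assms(3) by (intro joinedI) auto
  then obtain \<tau> where \<tau>: "\<tau> \<in> strings V E (f y) (f z)" "string_length \<tau> \<le> c"
    unfolding joined_def by blast
  have near: "joined c (f y) w" if "w \<in> set \<tau>" for w
    using joined_string[OF \<tau>(1) that] \<tau>(2) unfolding joined_def by (meson order_trans)
  have "set (\<sigma> @ tl \<tau>) \<subseteq> set \<sigma> \<union> set \<tau>" by (cases \<tau>) auto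
  then have "\<forall>w\<in>set (\<sigma> @ tl \<tau>). \<exists>a\<in>A. joined c (f a) w"
    using \<sigma>(2) near step.hyps(2) by blast
  with strings_append_tl(1)[OF \<sigma>(1) \<tau>(1)] step.hyps(2) show ?case by blast
qed

end

text \<open>A geodesic from \<open>x\<close> to \<open>y\<close> through \<open>m\<close> and an arbitrary chain from \<open>x\<close> to \<open>y\<close> both
  have images passing near the median of \<open>f x\<close>, \<open>f y\<close> and \<open>f m\<close>; the two halves of the geodesic
  can both return there only close to \<open>m\<close>.\<close>

lemma quasitree_bottleneck:
  assumes qt: "quasitree TYPE('v) M d" and L: "1 \<le> L"
  obtains \<Delta> where "0 \<le> \<Delta>" "Metric_space.bottleneck M d L \<Delta>"
proof -
  have geo: "geodesic_space M d" using qt by (simp add: quasitree_def)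
  then interpret Metric_space M d by (simp add: geodesic_space_def)
  obtain V :: "'v set" and E where tree: "simplicial_tree V E"
    and qi: "quasi_isometric M d (realization V E) (realization_dist V E)"
    using qt unfolding quasitree_def by blast
  interpret tree_realization V E by unfold_locales (rule tree)
  obtain f K C where f: "f \<in> M \<rightarrow> realization V E" and K: "1 \<le> K" and C: "0 \<le> C"
    and lower: "\<And>x y. x \<in> M \<Longrightarrow> y \<in> M \<Longrightarrow> d x y / K - C \<le> realization_dist V E (f x) (f y)"
    and upper: "\<And>x y. x \<in> M \<Longrightarrow> y \<in> M \<Longrightarrow> realization_dist V E (f x) (f y) \<le> K * d x y + C"
    using qi unfolding quasi_isometric_def by blast
  \<comment> \<open>A step of the chain is stretched to at most \<open>K * L + C\<close>; the extra
    1 gives the strict inequality under which the infimum yields a string. \<open>D\<close> bounds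
    the distance of two points whose images are within \<open>c + 1\<close> of the median, where the
    1 crosses a shared cell.\<close>
  define c where "c = K * L + C + 1"
  define D where "D = K * (2 * (c + 1) + C)"
  have "0 \<le> K * L" using K L by simp
  then have c: "0 \<le> c" using C unfolding c_def by linarith
  then have D: "0 \<le> D" using K C unfolding D_def by simp
  have pass: "\<exists>a\<in>A. joined (c + 1) (f a) p"
    if A: "A \<subseteq> M" "u \<in> A" "chained L A u v"
      and p: "\<forall>\<sigma>\<in>strings V E (f u) (f v). \<exists>w\<in>set \<sigma>. w = p \<or> share_cell V E w p"
    for A u v p
  proof -
    have "realization_dist V E (f a) (f b) < c" if "a \<in> A" "b \<in> A" "d a b \<le> L" for a b
    proof -
      have "realization_dist V E (f a) (f b) \<le> K * d a b + C" using upper A(1) that by blast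
      also have "\<dots> \<le> K * L + C" using that K by simp
      finally show ?thesis by (simp add: c_def)
    qed
    moreover have "f \<in> A \<rightarrow> realization V E" using f A(1) by blast
    ultimately obtain \<sigma> where \<sigma>: "\<sigma> \<in> strings V E (f u) (f v)" "\<forall>w\<in>set \<sigma>. \<exists>a\<in>A. joined c (f a) w"
      using chained_string[OF tree_realization_axioms _ _ A(3,2) c] by blast
    then obtain w a where w: "a \<in> A" "joined c (f a) w" "w = p \<or> share_cell V E w p"
      using p by blast
    then have "joined 1 w p" using joined_refl share_cell_joined by auto
    with w joined_trans show ?thesis by blast
  qed
  have close: "d a b \<le> D" if "a \<in> M" "b \<in> M" "joined (c + 1) (f a) p" "joined (c + 1) (f b) p" for a b p
  proof -
    have "joined ((c + 1) + (c + 1)) (f a) (f b)"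
      using that joined_trans joined_sym by blast
    then have "d a b / K - C \<le> 2 * (c + 1)"
      using realization_dist_le lower[OF that(1,2)] by force
    then show ?thesis using K by (simp add: D_def field_simps)
  qed
  have "bottleneck L (2 * D)"
    unfolding bottleneck_def
  proof (intro ballI allI impI)
    fix x y m A
    assume xy: "x \<in> M" "y \<in> M" and m: "m \<in> segment x y"
      and A: "A \<subseteq> M" "x \<in> A" "chained L A x y"
    have mM: "m \<in> M" using m by (simp add: segment_def)
    have fM: "f u \<in> realization V E" if "u \<in> M" for u using f that by blast
    obtain p where "\<forall>(u, v)\<in>{(f x, f m), (f x, f y), (f m, f y)}. \<forall>\<sigma>\<in>strings V E u v.
       \<exists>w\<in>set \<sigma>. w = p \<or> share_cell V E w p"
      using realization_median[OF fM[OF xy(1)] fM[OF mM] fM[OF xy(2)]] .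
    then have p: "\<forall>\<sigma>\<in>strings V E (f x) (f m). \<exists>w\<in>set \<sigma>. w = p \<or> share_cell V E w p"
      "\<forall>\<sigma>\<in>strings V E (f x) (f y). \<exists>w\<in>set \<sigma>. w = p \<or> share_cell V E w p"
      "\<forall>\<sigma>\<in>strings V E (f m) (f y). \<exists>w\<in>set \<sigma>. w = p \<or> share_cell V E w p"
      by simp_all
    have seg: "segment u v \<subseteq> M" for u v by (auto simp: segment_def)
    have ch: "chained L (segment u v) u v" if "u \<in> M" "v \<in> M" for u v
      using chained_mono[OF chained_segment[OF geo that]] L by blast
    obtain a where a: "a \<in> A" "joined (c + 1) (f a) p"
      using pass[OF A p(2)] by blast
    obtain a1 where a1: "a1 \<in> segment x m" "joined (c + 1) (f a1) p"
      using pass[OF seg _ ch[OF xy(1) mM] p(1)] segment_ends xy mM by blast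
    obtain a2 where a2: "a2 \<in> segment m y" "joined (c + 1) (f a2) p"
      using pass[OF seg _ ch[OF mM xy(2)] p(3)] segment_ends xy mM by blast
    have M: "a \<in> M" "a1 \<in> M" "a2 \<in> M" using a a1 a2 A by (auto simp: segment_def)
    \<comment> \<open>The points \<open>a1\<close>, \<open>m\<close>, \<open>a2\<close> lie in this
      order on a geodesic, so \<open>d a1 m\<close> is at most \<open>d a1 a2\<close>.\<close>
    have "d a1 a2 \<le> D" "d a a1 \<le> D" using close M a a1 a2 by blast+
    moreover have "d x y \<le> d x a1 + d a1 y" "d a1 y \<le> d a1 a2 + d a2 y" "d a m \<le> d a a1 + d a1 m"
      using triangle xy mM M by auto
    moreover have "d x m + d m y = d x y" "d x a1 + d a1 m = d x m" "d m a2 + d a2 y = d m y"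
      using m a1(1) a2(1) by (simp_all add: segment_def)
    ultimately have "d a m \<le> 2 * D" using nonneg[of m a2] by linarith
    with a(1) show "\<exists>a\<in>A. d a m \<le> 2 * D" by blast
  qed
  with D that[of "2 * D"] show thesis by simp
qed

section \<open>Estimates for Gromov products\<close>

context Metric_space
begin

lemma gromov_product_nonneg:
  assumes "a \<in> M" "x \<in> M" "y \<in> M" shows "0 \<le> gromov_product a x y"
  using triangle[of x a y] assms commute[of a y] by (simp add: gromov_product_def)

lemma gromov_product_le:
  assumes "a \<in> M" "x \<in> M" "y \<in> M" shows "gromov_product a x y \<le> d x a"
  using triangle[of y x a] assms commute[of x y] by (simp add: gromov_product_def)

lemma gromov_product_base_change:
  assumes "a \<in> M" "b \<in> M" "x \<in> M" "y \<in> M"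
  shows "gromov_product b x y \<le> gromov_product a x y + d a b"
  using triangle[of x a b] triangle[of y a b] assms unfolding gromov_product_def by argo

text \<open>The two products are the tangent lengths into which the incircle of the comparison
  triangle divides the side from \<open>a\<close> to \<open>b\<close>.\<close>

lemma gromov_product_corner: "gromov_product b a c = d a b - gromov_product a b c"
  using commute[of a b] commute[of a c] commute[of b c]
  by (simp add: gromov_product_def field_simps)

text \<open>An exchange rule: replacing \<open>x\<close> by a point \<open>y\<close> that shares a
  long initial stretch with it keeps a small product small, at the cost of \<delta>.\<close>

lemma four_pointD:
  assumes "four_point \<delta>" "w \<in> M" "x \<in> M" "y \<in> M" "z \<in> M"
    and "gromov_product w x z + \<delta> < gromov_product w x y"
  shows "gromov_product w y z \<le> gromov_product w x z + \<delta>"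
proof -
  have "min (gromov_product w x y) (gromov_product w y z) \<le> gromov_product w x z + \<delta>"
    using assms(1-5) unfolding four_point_def by blast
  with assms(6) show ?thesis by linarith
qed

text \<open>The points play the roles of \<open>p = u x\<close>, \<open>q = v x\<close>, \<open>z = v u x\<close> and, primed, of their
  images under the inverse elements. If neither \<open>u\<close> nor \<open>v\<close> translates far relative to its
  turning angle, then their product does.\<close>

lemma product_translates:
  assumes hyp: "four_point \<delta>" and nonneg: "0 \<le> \<delta>" "0 \<le> \<Delta>"
    and M: "x \<in> M" "p \<in> M" "p' \<in> M" "q \<in> M" "q' \<in> M" "z \<in> M" "z' \<in> M"
    and inverse: "d x p' = d x p" "d x q' = d x q" "d x z' = d x z"
    and z: "d x z = d q' p" "d z q = d x p" "d z' p' = d x q"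
    and pq: "gromov_product x q p \<le> \<Delta>"
    and far: "4 * \<Delta> + 20 * \<delta> < d x p" "4 * \<Delta> + 20 * \<delta> < d x q"
    and turn: "d x p \<le> 2 * gromov_product x p p' + 4 * \<delta>" "d x q \<le> 2 * gromov_product x q q' + 4 * \<delta>"
  shows "2 * gromov_product x z z' + 4 * \<delta> < d x z"
proof -
  have c: "d p x = d x p" "d q x = d x q" "d p' x = d x p'" "d q' x = d x q'" "d z x = d x z"
    "d z' x = d x z'" "d q z = d z q" "d p' z' = d z' p'"
    by (rule commute)+
  note c = c inverse z
  \<comment> \<open>Four exchanges at a cost of \<delta> each: \<open>q\<close> by \<open>q'\<close>
    and \<open>p\<close> by \<open>p'\<close>, whose products are large by \<open>turn\<close>; then
    \<open>q\<close> by \<open>z\<close> and \<open>p'\<close> by \<open>z'\<close>, whose products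
    are large because \<open>q'\<close> and \<open>p\<close> diverge early.\<close>
  have s1: "gromov_product x q' p \<le> \<Delta> + \<delta>"
    using four_pointD[OF hyp M(1,4,5,2)] turn(2) far pq nonneg by linarith
  have s2: "gromov_product x q p' \<le> \<Delta> + \<delta>"
    using four_pointD[OF hyp M(1,2,3,4)] turn(1) far pq nonneg
      gromov_product_commute[of x p q] gromov_product_commute[of x p' q] by linarith
  have z_len: "d x z = d x p + d x q - 2 * gromov_product x q' p"
    using c unfolding gromov_product_def by argo
  have "gromov_product x q z = d x q - gromov_product x q' p"
    using z_len c unfolding gromov_product_def by argo
  then have s3: "gromov_product x z p' \<le> \<Delta> + 2 * \<delta>"
    using four_pointD[OF hyp M(1,4,6,3)] s1 s2 far nonneg by linarith
  have "gromov_product x p' z' = d x p - gromov_product x q' p"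
    using z_len c unfolding gromov_product_def by argo
  then have "gromov_product x z z' \<le> \<Delta> + 3 * \<delta>"
    using four_pointD[OF hyp M(1,3,7,6)] s1 s3 far nonneg
      gromov_product_commute[of x p' z] gromov_product_commute[of x z' z] by linarith
  then show ?thesis using z_len s1 far nonneg by linarith
qed

text \<open>Gromov products never exceed the distance to the base point, so they cannot diverge
  along a bounded sequence.\<close>

lemma mbounded_no_accumulation:
  assumes "mbounded S" shows "boundary_accumulation_points S = {}"
proof (rule ccontr)
  assume "boundary_accumulation_points S \<noteq> {}"
  then obtain \<xi> u where \<xi>: "\<xi> \<in> gromov_boundary" and u: "u \<in> \<xi>" "range u \<subseteq> S"
    unfolding boundary_accumulation_points_def by blast
  then have seq: "gromov_sequence u"
    unfolding gromov_boundary_def gromov_rel_def by (auto elim!: quotientE)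
  then have M: "u n \<in> M" for n unfolding gromov_sequence_def by blast
  obtain B where B: "d (u m) (u n) \<le> B" for m n
    using mbounded_subset[OF assms u(2)] unfolding mbounded_alt by blast
  have "filterlim (\<lambda>(m, n). gromov_product (u 0) (u m) (u n)) at_top (sequentially \<times>\<^sub>F sequentially)"
    using seq M unfolding gromov_sequence_def by blast
  then have "eventually (\<lambda>(m, n). gromov_product (u 0) (u m) (u n) > B) (sequentially \<times>\<^sub>F sequentially)"
    unfolding filterlim_at_top_dense by (auto simp: case_prod_unfold)
  moreover have "\<not> gromov_product (u 0) (u m) (u n) > B" for m n
    using gromov_product_le[OF M M M] B[of m 0] by (meson leD order_trans)
  ultimately have "eventually (\<lambda>_. False) ((sequentially :: nat filter) \<times>\<^sub>F (sequentially :: nat filter))"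
    by (simp add: case_prod_unfold)
  then show False by (simp add: prod_filter_eq_bot)
qed

end

section \<open>Loxodromic orbits\<close>

text \<open>The orbit of a cyclic group, stripped of the group, so that reversing the index gives
  another instance and results on one end transfer to the other. The bound in \<open>long\<close> is
  twice \<open>a + 2 * \<delta>\<close>, the turning that accumulates at a corner in the worst
  case.\<close>

locale translation_orbit = Metric_space +
  fixes X :: "int \<Rightarrow> 'a" and \<delta> a :: real
  assumes X: "X i \<in> M"
    and shift: "d (X (k + i)) (X (k + j)) = d (X i) (X j)"
    and hyp: "four_point \<delta>" and \<delta>: "0 \<le> \<delta>"
    and turn: "gromov_product (X 0) (X (-1)) (X 1) \<le> a"
    and long: "2 * a + 4 * \<delta> < d (X 0) (X 1)"
begin

lemma shift_product:
  "gromov_product (X (k + l)) (X (k + i)) (X (k + j)) = gromov_product (X l) (X i) (X j)"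
  by (simp add: gromov_product_def shift)

lemma a_nonneg: "0 \<le> a"
  using turn gromov_product_nonneg[OF X X X] by (rule order_trans[rotated])

lemma reverse: "translation_orbit M d (\<lambda>i. X (- i)) \<delta> a"
proof unfold_locales
  show "d (X (- (k + i))) (X (- (k + j))) = d (X (- i)) (X (- j))" for k i j
    using shift[of "- k" "- i" "- j"] by simp
  show "2 * a + 4 * \<delta> < d (X (- 0)) (X (- 1))"
    using long shift[of "-1" 0 1] commute[of "X (-1)" "X 0"] by simp
  show "gromov_product (X (- 0)) (X (- (- 1))) (X (- 1)) \<le> a"
    using turn gromov_product_commute[of "X 0"] by simp
qed (use X hyp \<delta> in simp_all)

text \<open>Shifted by one, the premise bounds the turn at \<open>X 1\<close>; hence, seen from
  \<open>X 0\<close>, the point \<open>X (i + 1)\<close> lies behind \<open>X 1\<close>.\<close>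

lemma side_product:
  assumes "gromov_product (X 0) (X (-1)) (X i) \<le> a + \<delta>"
  shows "d (X 0) (X 1) - a - \<delta> \<le> gromov_product (X 0) (X 1) (X (i + 1))"
proof -
  have "gromov_product (X 1) (X 0) (X (i + 1)) = gromov_product (X 0) (X (-1)) (X i)"
    using shift_product[of 1 0 "-1" i] by (simp add: add.commute)
  then show ?thesis
    using assms gromov_product_corner[of "X 1" "X 0" "X (i + 1)"] by simp
qed

text \<open>Local-to-global: at every corner the orbit turns by a bounded amount while its steps are
  long, so in a hyperbolic space the turning stays bounded along the whole orbit.\<close>

lemma product_forward: "gromov_product (X 0) (X (-1)) (X (int n + 1)) \<le> a + \<delta>"
proof (induction n)
  case 0
  then show ?case using turn \<delta> by simp
next
  case (Suc n)
  have "d (X 0) (X 1) - a - \<delta> \<le> gromov_product (X 0) (X 1) (X (int (Suc n) + 1))"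
    using side_product[OF Suc] by (simp add: algebra_simps)
  then have "gromov_product (X 0) (X 1) (X (-1)) + \<delta> < gromov_product (X 0) (X 1) (X (int (Suc n) + 1))"
    using turn long \<delta> gromov_product_commute[of "X 0" "X 1" "X (-1)"] a_nonneg by linarith
  from four_pointD[OF hyp X X X X this] show ?case
    using turn gromov_product_commute[of "X 0" "X (-1)"] by (metis add_mono order_refl order_trans)
qed

lemma product_backward:
  "d (X 0) (X 1) - a - \<delta> \<le> gromov_product (X 0) (X (-1)) (X (- int n - 1))"
proof -
  interpret rev: translation_orbit M d "\<lambda>i. X (- i)" \<delta> a by (rule reverse)
  have step: "d (X 0) (X (-1)) = d (X 0) (X 1)"
    using shift[of "-1" 0 1] commute[of "X (-1)" "X 0"] by simp
  show ?thesis
  proof (cases n)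
    case 0
    then show ?thesis
      using step a_nonneg \<delta> commute[of "X 0" "X (-1)"] mdist_zero[OF X[of "-1"]]
      by (simp add: gromov_product_def)
  next
    case (Suc k)
    then show ?thesis
      using rev.side_product[OF rev.product_forward[of k]] step by (simp add: algebra_simps)
  qed
qed

text \<open>Seen from \<open>X 0\<close>, the points \<open>X (-1)\<close> and
  \<open>X (- int m - 1)\<close> share a long stretch; exchanging them costs the second
  \<delta>.\<close>

lemma product_two_sided: "gromov_product (X 0) (X (- int m - 1)) (X (int n + 1)) \<le> a + 2 * \<delta>"
proof -
  have "gromov_product (X 0) (X (-1)) (X (int n + 1)) + \<delta> < gromov_product (X 0) (X (-1)) (X (- int m - 1))"
    using product_forward[of n] product_backward[of m] long \<delta> by linarith
  from four_pointD[OF hyp X X X X this] product_forward[of n] show ?thesis by linarith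
qed

lemma corner_product:
  assumes "i \<le> j" "j \<le> k" shows "gromov_product (X j) (X i) (X k) \<le> a + 2 * \<delta>"
proof (cases "i = j \<or> j = k")
  case True
  then have "gromov_product (X j) (X i) (X k) = 0"
    using X commute[of "X i" "X j"] commute[of "X k" "X j"] by (auto simp: gromov_product_def)
  then show ?thesis using a_nonneg \<delta> by simp
next
  case False
  define m n where "m = nat (j - i - 1)" and "n = nat (k - j - 1)"
  have "i = j + (- int m - 1)" "k = j + (int n + 1)"
    using False assms unfolding m_def n_def by auto
  then show ?thesis
    using shift_product[of j 0] product_two_sided[of m n] by simp
qed

text \<open>The net gain per step: the step length minus twice the corner bound
  \<open>a + 2 * \<delta>\<close>.\<close>

definition \<eta> :: real where "\<eta> = d (X 0) (X 1) - 2 * a - 4 * \<delta>"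

lemma eta_pos: "0 < \<eta>"
  using long by (simp add: \<eta>_def)

lemma linear_growth: "real n * \<eta> \<le> d (X 0) (X (int n))"
proof (induction n)
  case (Suc n)
  have "gromov_product (X (int n)) (X 0) (X (int n + 1)) \<le> a + 2 * \<delta>"
    by (rule corner_product) simp_all
  moreover have "d (X (int n + 1)) (X (int n)) = d (X 0) (X 1)"
    using shift[of "int n" 1 0] commute[of "X 0" "X 1"] by simp
  ultimately have "d (X 0) (X (int n)) + \<eta> \<le> d (X 0) (X (int n + 1))"
    unfolding gromov_product_def \<eta>_def by argo
  with Suc show ?case by (simp add: algebra_simps)
qed simp

lemma gromov_sequence_forward: "gromov_sequence (\<lambda>n. X (int n))"
  unfolding gromov_sequence_def
proof (intro conjI ballI)
  fix b assume b: "b \<in> M"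
  \<comment> \<open>The corner bound at the earlier of the two points, plus the cost of moving the
    base point from \<open>X 0\<close> to \<open>b\<close>.\<close>
  define c where "c = a + 2 * \<delta> + d (X 0) b"
  have le: "real m * \<eta> - c \<le> gromov_product b (X (int m)) (X (int n))" if "m \<le> n" for m n
  proof -
    have "gromov_product (X (int m)) (X 0) (X (int n)) \<le> a + 2 * \<delta>"
      using that by (intro corner_product) auto
    then have "real m * \<eta> - (a + 2 * \<delta>) \<le> gromov_product (X 0) (X (int m)) (X (int n))"
      using gromov_product_corner[of "X 0" "X (int m)"] linear_growth[of m] commute[of "X 0" "X (int m)"]
      by simp
    then show ?thesis
      using gromov_product_base_change[OF b X X X, of 0 "int m" "int n"] commute[of b "X 0"]
      by (simp add: c_def)
  qed
  have min: "real N * \<eta> - c \<le> gromov_product b (X (int m)) (X (int n))" if "N \<le> m" "N \<le> n" for N m n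
  proof -
    have "real N * \<eta> \<le> real (min m n) * \<eta>" using that eta_pos by simp
    then show ?thesis
      using le[of m n] le[of n m] gromov_product_commute[of b "X (int m)" "X (int n)"]
      by (cases "m \<le> n") (auto simp: min_def)
  qed
  show "filterlim (\<lambda>(m, n). gromov_product b (X (int m)) (X (int n))) at_top (sequentially \<times>\<^sub>F sequentially)"
    unfolding filterlim_at_top
  proof
    fix Z
    obtain N :: nat where N: "(Z + c) / \<eta> \<le> real N" using real_arch_simple by blast
    then have "Z \<le> real N * \<eta> - c" using eta_pos by (simp add: field_simps)
    then have "Z \<le> gromov_product b (X (int m)) (X (int n))" if "N \<le> m" "N \<le> n" for m n
      using min[OF that] by simp
    then show "eventually (\<lambda>x. Z \<le> (case x of (m, n) \<Rightarrow> gromov_product b (X (int m)) (X (int n))))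
        (sequentially \<times>\<^sub>F sequentially)"
      unfolding eventually_prod_filter
      by (intro exI[of _ "\<lambda>n. N \<le> n"]) (simp add: eventually_ge_at_top)
  qed
qed (use X in auto)

lemma two_accumulation_points:
  assumes "range X \<subseteq> S" shows "boundary_accumulation_points S \<noteq> {\<xi>}"
proof
  assume eq: "boundary_accumulation_points S = {\<xi>}"
  interpret rev: translation_orbit M d "\<lambda>i. X (- i)" \<delta> a by (rule reverse)
  have point: "gromov_rel `` {u} = \<xi> \<and> u \<in> \<xi>"
    if u: "gromov_sequence u" "range u \<subseteq> S" for u
  proof -
    have "filterlim (\<lambda>n. gromov_product b (u n) (u n)) at_top sequentially" if "b \<in> M" for b
    proof -
      have "filterlim (\<lambda>(m, n). gromov_product b (u m) (u n)) at_top (sequentially \<times>\<^sub>F sequentially)"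
        using u(1) that unfolding gromov_sequence_def by blast
      \<comment> \<open>Restricting the double limit to the diagonal shows that a Gromov sequence is
        related to itself, so its class contains it.\<close>
      from filterlim_compose[OF this filterlim_Pair[OF filterlim_ident filterlim_ident]]
      show ?thesis unfolding prod.case .
    qed
    then have "(u, u) \<in> gromov_rel" using u(1) by (simp add: gromov_rel_def)
    moreover have "gromov_rel `` {u} \<in> gromov_boundary"
      unfolding gromov_boundary_def using u(1) by (simp add: quotientI)
    ultimately have "gromov_rel `` {u} \<in> boundary_accumulation_points S"
      using u(2) unfolding boundary_accumulation_points_def by blast
    then have "gromov_rel `` {u} = \<xi>" using eq by simp
    with \<open>(u, u) \<in> gromov_rel\<close> show ?thesis by blast
  qed
  have X_S: "range (\<lambda>n. X (f n)) \<subseteq> S" for f :: "nat \<Rightarrow> int" using assms by auto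
  let ?u = "\<lambda>n. X (int n)" and ?v = "\<lambda>n. X (- int n)"
  have "gromov_rel `` {?u} = \<xi>"
    using point[OF gromov_sequence_forward] X_S by simp
  moreover have "?v \<in> \<xi>"
    using point[OF rev.gromov_sequence_forward] X_S by simp
  ultimately have "?v \<in> gromov_rel `` {?u}" by simp
  then have "(?u, ?v) \<in> gromov_rel" by simp
  then have "filterlim (\<lambda>n. gromov_product (X 0) (?u n) (?v n)) at_top sequentially"
    using X[of 0] by (simp add: gromov_rel_def)
  then have "eventually (\<lambda>n. gromov_product (X 0) (?u n) (?v n) > a + 2 * \<delta>) sequentially"
    by (simp add: filterlim_at_top_dense)
  then obtain n where "gromov_product (X 0) (?u n) (?v n) > a + 2 * \<delta>"
    by (auto simp: eventually_sequentially)
  then show False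
    using corner_product[of "- int n" 0 "int n"] gromov_product_commute[of "X 0" "?u n" "?v n"] by simp
qed

lemma unbounded: "range X \<subseteq> S \<Longrightarrow> \<not> mbounded S"
proof
  assume S: "range X \<subseteq> S" "mbounded S"
  then obtain B where B: "\<And>x y. x \<in> S \<Longrightarrow> y \<in> S \<Longrightarrow> d x y \<le> B" unfolding mbounded_alt by blast
  obtain n :: nat where "B < real n * \<eta>" using eta_pos ex_less_of_nat_mult by blast
  moreover have "d (X 0) (X (int n)) \<le> B" using S(1) by (intro B) auto
  ultimately show False using linear_growth[of n] by linarith
qed

end

section \<open>Finitely generated actions\<close>

context isometric_action
begin

interpretation group G using group_hom by (simp add: group_hom_def)

lemma action_closed [simp]: "g \<in> carrier G \<Longrightarrow> x \<in> M \<Longrightarrow> \<phi> g x \<in> M"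
  using element_image[of g x "\<phi> g x"] by simp

lemma orbit_subset: "x \<in> M \<Longrightarrow> orbit G \<phi> x \<subseteq> M"
  by (auto simp: orbit_def)

lemma action_one: "x \<in> M \<Longrightarrow> \<phi> \<one> x = x"
  using id_eq_one by (metis restrict_apply')

lemma dist_action_inv:
  assumes "g \<in> carrier G" "x \<in> M" "y \<in> M"
  shows "d (\<phi> (inv g) x) y = d x (\<phi> g y)"
proof -
  have "\<phi> g (\<phi> (inv g) x) = \<phi> (g \<otimes> inv g) x" 
    by (rule composition_rule[symmetric]) (use assms in simp_all)
  also have "\<dots> = x" using assms by (simp add: action_one)
  finally show ?thesis using isometry[of g "\<phi> (inv g) x" y] assms by simp
qed

text \<open>A word in the generators traces a path in the orbit: as translations are isometries,
  appending a letter moves the current point exactly as far as that letter moves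
  \<open>x\<close>.\<close>

lemma finitely_generated_orbit_chained:
  assumes fg: "finitely_generated G" and x: "x \<in> M"
  obtains L where "1 \<le> L" "\<And>g. g \<in> carrier G \<Longrightarrow> chained L (orbit G \<phi> x) x (\<phi> g x)"
proof -
  obtain S where S: "finite S" "S \<subseteq> carrier G" "generate G S = carrier G"
    using fg unfolding finitely_generated_def by blast
  \<comment> \<open>The inserted 1 keeps the maximum defined without generators and gives the bound
    \<open>1 \<le> L\<close> that the bottleneck lemma asks for.\<close>
  define L where "L = Max (insert 1 ((\<lambda>s. d x (\<phi> s x)) ` S))"
  have L: "1 \<le> L" "\<And>s. s \<in> S \<Longrightarrow> d x (\<phi> s x) \<le> L"
    using S(1) by (auto simp: L_def)
  let ?O = "orbit G \<phi> x"
  have orb: "\<phi> g x \<in> ?O" if "g \<in> carrier G" for g using that by (auto simp: orbit_def)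
  \<comment> \<open>An arbitrary start \<open>k\<close> is needed for products, whose second factor
    continues where the first one ends.\<close>
  have "chained L ?O (\<phi> k x) (\<phi> (k \<otimes> g) x)" if "g \<in> generate G S" "k \<in> carrier G" for g k
    using that
  proof (induction arbitrary: k rule: generate.induct)
    case one
    then show ?case by (simp add: chained_refl)
  next
    case (incl s)
    have s: "s \<in> carrier G" using incl S(2) by blast
    have "d (\<phi> k x) (\<phi> (k \<otimes> s) x) = d x (\<phi> s x)"
      using incl s x by (simp add: composition_rule isometry)
    with incl s show ?case by (intro chained_step) (simp_all add: L orb)
  next
    case (inv s)
    have s: "s \<in> carrier G" using inv S(2) by blast
    have "d (\<phi> k x) (\<phi> (k \<otimes> inv s) x) = d x (\<phi> s x)"
      using inv s x dist_action_inv[OF s x x] commute[of x "\<phi> (inv s) x"]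
      by (simp add: composition_rule isometry)
    with inv s show ?case by (intro chained_step) (simp_all add: L orb)
  next
    case (eng h1 h2)
    have h: "h1 \<in> carrier G" "h2 \<in> carrier G" using eng(1,2) S(3) by auto
    have "chained L ?O (\<phi> (k \<otimes> h1) x) (\<phi> ((k \<otimes> h1) \<otimes> h2) x)"
      using eng h by simp
    with eng(3)[OF eng(5)] have "chained L ?O (\<phi> k x) (\<phi> ((k \<otimes> h1) \<otimes> h2) x)"
      by (rule chained_trans)
    then show ?case using eng(5) h by (simp add: m_assoc)
  qed
  from this[of _ \<one>] have "chained L ?O x (\<phi> g x)" if "g \<in> carrier G" for g
    using that S(3) x by (simp add: action_one)
  with L(1) that show thesis by blast
qed

lemma translation_orbit_powers:
  assumes "four_point \<delta>" "0 \<le> \<delta>" "x \<in> M" "g \<in> carrier G"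
    and "2 * gromov_product x (\<phi> g x) (\<phi> (inv g) x) + 4 * \<delta> < d x (\<phi> g x)"
  shows "translation_orbit M d (\<lambda>i::int. \<phi> (g [^] i) x) \<delta> (gromov_product x (\<phi> g x) (\<phi> (inv g) x))"
proof unfold_locales
  fix k i j :: int
  show "d (\<phi> (g [^] (k + i)) x) (\<phi> (g [^] (k + j)) x) = d (\<phi> (g [^] i) x) (\<phi> (g [^] j) x)"
    using assms(3,4) by (simp add: int_pow_mult composition_rule isometry)
  show "gromov_product (\<phi> (g [^] (0::int)) x) (\<phi> (g [^] (-1::int)) x) (\<phi> (g [^] (1::int)) x)
      \<le> gromov_product x (\<phi> g x) (\<phi> (inv g) x)"
    using assms(3,4) int_pow_neg[of g 1]
    by (simp add: action_one gromov_product_commute[of x "\<phi> g x"])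
qed (use assms in \<open>simp_all add: action_one\<close>)

text \<open>The orbit is a chain, so it passes near the midpoint of \<open>x\<close> and a far orbit point \<open>\<phi> g x\<close>,
  say at \<open>\<phi> h x\<close>. Seen from there, \<open>x\<close> and \<open>\<phi> g x\<close> lie in different directions, which makes one of
  \<open>inv h\<close>, \<open>inv h \<otimes> g\<close> and their product loxodromic.\<close>

lemma unbounded_orbit_loxodromic:
  assumes geo: "geodesic_space M d" and hyp: "four_point \<delta>" and nonneg: "0 \<le> \<delta>" "0 \<le> \<Delta>"
    and bn: "bottleneck L \<Delta>" and x: "x \<in> M"
    and chain: "\<And>g. g \<in> carrier G \<Longrightarrow> chained L (orbit G \<phi> x) x (\<phi> g x)"
    and unb: "\<not> mbounded (orbit G \<phi> x)"
  shows "\<exists>g\<in>carrier G. 2 * gromov_product x (\<phi> g x) (\<phi> (inv g) x) + 4 * \<delta> < d x (\<phi> g x)"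
proof -
  \<comment> \<open>Half of \<open>R\<close> is the threshold
    \<open>4 * \<Delta> + 20 * \<delta>\<close> of \<open>product_translates\<close> plus the error
    \<Delta> of the orbit point near the midpoint.\<close>
  define R where "R = 2 * (5 * \<Delta> + 20 * \<delta>)"
  have "\<exists>g\<in>carrier G. R < d x (\<phi> g x)"
  proof (rule ccontr)
    assume "\<not> ?thesis"
    then have "\<forall>y\<in>orbit G \<phi> x. d x y \<le> R" by (force simp: orbit_def)
    then have "mbounded (orbit G \<phi> x)"
      unfolding mbounded using orbit_subset[OF x] x by blast
    with unb show False by blast
  qed
  then obtain g where g: "g \<in> carrier G" "R < d x (\<phi> g x)" by blast
  have gM: "\<phi> g x \<in> M" using g x by simp
  obtain m where m: "m \<in> segment x (\<phi> g x)" "d x m = d x (\<phi> g x) / 2"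
    by (rule geodesic_pointE[OF geo x gM, of "d x (\<phi> g x) / 2"]) simp_all
  have mM: "m \<in> M" and m': "d m (\<phi> g x) = d x (\<phi> g x) / 2"
    using m by (auto simp: segment_def)
  have "\<exists>y\<in>orbit G \<phi> x. d y m \<le> \<Delta>"
    using bn x gM m(1) orbit_subset[OF x] orbit_refl[OF x] chain[OF g(1)]
    unfolding bottleneck_def by blast
  then obtain h where h: "h \<in> carrier G" "d (\<phi> h x) m \<le> \<Delta>"
    unfolding orbit_def by blast
  have hM: "\<phi> h x \<in> M" using h x by simp
  \<comment> \<open>Translating by \<open>inv h\<close> moves the orbit point near the midpoint to
    \<open>x\<close>, and the two ends \<open>x\<close> and \<open>\<phi> g x\<close> to
    \<open>\<phi> u x\<close> and \<open>\<phi> v x\<close>.\<close>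
  define u v where "u = inv h" and "v = inv h \<otimes> g"
  have uv: "u \<in> carrier G" "v \<in> carrier G" using g h by (auto simp: u_def v_def)
  have u: "d (\<phi> u x) y = d x (\<phi> h y)" if "y \<in> M" for y
    unfolding u_def using dist_action_inv h(1) x that .
  have norm_u: "d x (\<phi> u x) = d (\<phi> h x) x"
    using u[OF x] commute[of "\<phi> h x" x] commute[of "\<phi> u x" x] by simp
  have norm_v: "d x (\<phi> v x) = d (\<phi> h x) (\<phi> g x)"
    using dist_action_inv[OF h(1) gM x] commute[of x "\<phi> v x"] commute[of "\<phi> g x" "\<phi> h x"] g(1) h(1) x
    by (simp add: v_def composition_rule)
  have uv_dist: "d (\<phi> v x) (\<phi> u x) = d x (\<phi> g x)"
    using commute[of "\<phi> g x" x] g(1) h(1) x gM by (simp add: v_def u_def composition_rule isometry)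
  have tri: "d x m \<le> d (\<phi> h x) x + d (\<phi> h x) m" "d m (\<phi> g x) \<le> d (\<phi> h x) m + d (\<phi> h x) (\<phi> g x)"
    "d (\<phi> h x) x \<le> d (\<phi> h x) m + d x m" "d (\<phi> h x) (\<phi> g x) \<le> d (\<phi> h x) m + d m (\<phi> g x)"
    using triangle[OF x hM mM] triangle[OF mM hM gM] triangle[OF hM mM x] triangle[OF hM mM gM]
      commute[of x m] commute[of x "\<phi> h x"] commute[of m "\<phi> h x"] by linarith+
  have far: "4 * \<Delta> + 20 * \<delta> < d x (\<phi> u x)" "4 * \<Delta> + 20 * \<delta> < d x (\<phi> v x)"
    using tri m(2) m' h(2) g(2) norm_u norm_v unfolding R_def by argo+
  \<comment> \<open>The detour from \<open>x\<close> to \<open>\<phi> g x\<close> via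
    \<open>\<phi> h x\<close> exceeds the geodesic through \<open>m\<close> by at most
    \<open>2 * \<Delta>\<close>, which the product halves.\<close>
  have prod: "gromov_product x (\<phi> v x) (\<phi> u x) \<le> \<Delta>"
    using tri m(2) m' h(2) norm_u norm_v uv_dist commute[of x "\<phi> u x"] commute[of x "\<phi> v x"]
    unfolding gromov_product_def by argo
  show ?thesis
  proof (rule ccontr)
    assume no: "\<not> ?thesis"
    have turn: "d x (\<phi> k x) \<le> 2 * gromov_product x (\<phi> k x) (\<phi> (inv k) x) + 4 * \<delta>"
      if "k \<in> carrier G" for k
      using that no by (meson not_le)
    let ?w = "v \<otimes> u"
    have w: "?w \<in> carrier G" using uv by simp
    have norm_inv: "d x (\<phi> (inv k) x) = d x (\<phi> k x)" if "k \<in> carrier G" for k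
      using dist_action_inv[OF that x x] commute[of "\<phi> (inv k) x" x] by simp
    have "2 * gromov_product x (\<phi> ?w x) (\<phi> (inv ?w) x) + 4 * \<delta> < d x (\<phi> ?w x)"
    proof (rule product_translates[OF hyp nonneg x, where p = "\<phi> u x" and p' = "\<phi> (inv u) x"
          and q = "\<phi> v x" and q' = "\<phi> (inv v) x"])
      show "d x (\<phi> ?w x) = d (\<phi> (inv v) x) (\<phi> u x)"
        using uv x by (simp add: composition_rule dist_action_inv)
      show "d (\<phi> ?w x) (\<phi> v x) = d x (\<phi> u x)"
        using uv x commute[of x "\<phi> u x"] by (simp add: composition_rule isometry)
      show "d (\<phi> (inv ?w) x) (\<phi> (inv u) x) = d x (\<phi> v x)"
        using uv(1,2) x norm_inv[OF uv(2)] commute[of x "\<phi> (inv v) x"]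
        by (simp add: inv_mult_group composition_rule isometry)
    qed (use uv w x norm_inv prod far turn in simp_all)
    with turn[OF w] show False by simp
  qed
qed

end

theorem corollary5p9:
  fixes G :: "('g, 'm) monoid_scheme"
    and Q :: "'q set"
    and d :: "'q \<Rightarrow> 'q \<Rightarrow> real"
    and \<phi> :: "'g \<Rightarrow> 'q \<Rightarrow> 'q"
  assumes "quasitree TYPE('v) Q d"
    and "isometric_action G Q d \<phi>"
    and "finitely_generated G"
  shows "\<not> parabolic_action G Q d \<phi> \<and>
         ((\<forall>g\<in>carrier G. acts_elliptically G Q d \<phi> g) \<longrightarrow> bounded_orbits G Q d \<phi>)"
proof -
  interpret isometric_action G Q d \<phi> by (rule assms(2))
  interpret group G using group_hom by (simp add: group_hom_def)
  have geo: "geodesic_space Q d" using assms(1) by (simp add: quasitree_def)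
  obtain \<Delta> where \<Delta>: "0 \<le> \<Delta>" "bottleneck 1 \<Delta>"
    using quasitree_bottleneck[OF assms(1) order_refl] .
  define \<delta> where "\<delta> = 4 * \<Delta>"
  have \<delta>: "0 \<le> \<delta>" "four_point \<delta>"
    unfolding \<delta>_def using \<Delta> bottleneck_imp_four_point[OF geo] by simp_all
  have dichotomy: "mbounded (orbit G \<phi> x) \<or>
      (\<exists>g\<in>carrier G. \<exists>a. translation_orbit Q d (\<lambda>i::int. \<phi> (g [^]\<^bsub>G\<^esub> i) x) \<delta> a)"
    if x: "x \<in> Q" for x
  proof -
    obtain L where L: "1 \<le> L" "\<And>g. g \<in> carrier G \<Longrightarrow> chained L (orbit G \<phi> x) x (\<phi> g x)"
      using finitely_generated_orbit_chained[OF assms(3) x] by blast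
    \<comment> \<open>The step length \<open>L\<close> depends on \<open>x\<close>, and with it this
      constant; \<delta> comes from chains of step 1 and serves all orbits.\<close>
    obtain \<Delta>' where "0 \<le> \<Delta>'" "bottleneck L \<Delta>'"
      using quasitree_bottleneck[OF assms(1) L(1)] .
    then show ?thesis
      using unbounded_orbit_loxodromic[OF geo \<delta>(2,1) _ _ x L(2), of \<Delta>']
        translation_orbit_powers[OF \<delta>(2,1) x] by blast
  qed
  show ?thesis
  proof (intro conjI impI)
    show "\<not> parabolic_action G Q d \<phi>"
    proof
      assume "parabolic_action G Q d \<phi>"
      then obtain x \<xi> where x: "x \<in> Q" and lim: "boundary_accumulation_points (orbit G \<phi> x) = {\<xi>}"
        unfolding parabolic_action_def limit_set_def by blast
      have "\<not> mbounded (orbit G \<phi> x)" using lim mbounded_no_accumulation by force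
      then obtain g a where g: "g \<in> carrier G"
        and tr: "translation_orbit Q d (\<lambda>i::int. \<phi> (g [^]\<^bsub>G\<^esub> i) x) \<delta> a"
        using dichotomy[OF x] by blast
      have "range (\<lambda>i::int. \<phi> (g [^]\<^bsub>G\<^esub> i) x) \<subseteq> orbit G \<phi> x"
        using g by (auto simp: orbit_def)
      from translation_orbit.two_accumulation_points[OF tr this] lim show False by blast
    qed
    assume ell: "\<forall>g\<in>carrier G. acts_elliptically G Q d \<phi> g"
    show "bounded_orbits G Q d \<phi>"
      unfolding bounded_orbits_def
    proof (intro ballI, rule ccontr)
      fix x assume x: "x \<in> Q" and "\<not> mbounded (orbit G \<phi> x)"
      then obtain g a where g: "g \<in> carrier G"
        and tr: "translation_orbit Q d (\<lambda>i::int. \<phi> (g [^]\<^bsub>G\<^esub> i) x) \<delta> a"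
        using dichotomy[OF x] by blast
      \<comment> \<open>The powers of the single element \<open>g\<close> already leave every
        bounded set, which contradicts its ellipticity.\<close>
      have "range (\<lambda>i::int. \<phi> (g [^]\<^bsub>G\<^esub> i) x) \<subseteq> orbit (subgroup_generated G {g}) \<phi> x"
        using g by (auto simp: orbit_def carrier_subgroup_generated generate_pow)
      moreover have "mbounded (orbit (subgroup_generated G {g}) \<phi> x)"
        using ell g x unfolding acts_elliptically_def bounded_orbits_def by blast
      ultimately show False using translation_orbit.unbounded[OF tr] by blast
    qed
  qed
qed

end
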